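(* There exists a (randomized) estimation algorithm such that the following holds for every dataset $S=((x_1,y_1),\ldots,(x_n,y_n)) \in (X\times Y)^n$, every (randomized) learning algorithm $\mathcal{A}$, every example $z=(x,y)\in X\times Y$, every $m\in\{1,\ldots,n\}$ and every integer $t\ge 1$. The estimation algorithm runs $\mathcal{A}$ $t$ times in total and outputs estimates $(\mu_i)_{i\in\{1,\ldots,n\}}$ such that for every $i\in\{1,\ldots,n\}$, with $p=\min(m/n,\,1-m/n)$, $$\mathbb{E}\left[\left(\mathtt{infl}_m(\mathcal{A},S,i,z)-\mu_i\right)^2\right]\le \frac{1}{pt}+\frac{1}{(1-p)t}+\frac{e^{-pt/16}}{2},$$ where the expectation is with respect to the randomness of $\mathcal{A}$ and the randomness of the estimation algorithm. (When $p=0$, i.e. $m=n$, the right-hand side is interpreted as $+\infty$.)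
   Context: Let $X$ be a domain and $Y$ a set of labels. A learning algorithm $\mathcal{A}$ is a randomized procedure that takes a finite dataset (a finite sequence of elements of $X\times Y$, possibly empty) and outputs a model $h: X\to Y$; $h\leftarrow\mathcal{A}(S)$ means that $h$ is the random output of $\mathcal{A}$ run on $S$. Different runs of $\mathcal{A}$ use independent randomness. The estimation algorithm is given $S$, $z$, $m$, $t$ and has access to $\mathcal{A}$ only by running it: it may run $\mathcal{A}$ on $t$ datasets of its choice (chosen possibly at random), and it may evaluate the resulting models. The same $t$ runs are used to produce all $n$ estimates $\mu_1,\ldots,\mu_n$. Write $[n]=\{1,\ldots,n\}$. For a dataset $S=((x_1,y_1),\ldots,(x_n,y_n))$ and $i \in [n]$, $S^{\setminus i}$ denotes $S$ with $(x_i,y_i)$ removed. For a set of indices $I\subseteq[n]$, $S_I=(x_i,y_i)_{i\in I}$ is the dataset consisting of the examples of $S$ with indices in $I$. For $J\subseteq[n]$, $P(J,m)$ denotes the uniform distribution over all subsets of $J$ of size $m$. For an example $z=(x,y)$, the influence of the $i$-th example of $S$ on the expected accuracy at $z$ is $$\mathtt{infl}(\mathcal{A},S,i,z):=\Pr_{h\leftarrow\mathcal{A}(S)}[h(x)=y]-\Pr_{h\leftarrow\mathcal{A}(S^{\setminus i})}[h(x)=y].$$ The subsampled influence is $$\mathtt{infl}_m(\mathcal{A},S,i,z):=\mathbb{E}_{I\sim P([n]\setminus\{i\},\,m-1)}\left[\mathtt{infl}(\mathcal{A},S_{I\cup\{i\}},i,z)\right],$$ where in $\mathtt{infl}(\mathcal{A},S_{I\cup\{i\}},i,z)$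 the removed example is $(x_i,y_i)$, so that $(S_{I\cup\{i\}})^{\setminus i}=S_I$. *)

theory Defs
  imports "HOL-Probability.Probability"
begin

type_synonym ('x, 'y) dataset = "('x \<times> 'y) list"


section \<open>Learning algorithms and influence\<close>

text \<open>Models carry the coarsest sigma-algebra in which every event ``the model predicts \<open>y\<close> at \<open>x\<close>''
  is measurable. Any random model for which these probabilities make sense has a law on it, so
  no discreteness of \<open>'x\<close>, \<open>'y\<close> or of the randomness is assumed.\<close>

definition model_space :: "('x \<Rightarrow> 'y) measure" where
  "model_space = sigma UNIV {{h. h x = y} | x y. True}"

text \<open>\<open>A S\<close> is the law of the model returned by one run of the algorithm on \<open>S\<close>.\<close>

definition learning_algorithm :: "(('x, 'y) dataset \<Rightarrow> ('x \<Rightarrow> 'y) measure) \<Rightarrow> bool" where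
  "learning_algorithm A \<longleftrightarrow> (\<forall>S. prob_space (A S) \<and> sets (A S) = sets model_space)"

definition acc :: "(('x, 'y) dataset \<Rightarrow> ('x \<Rightarrow> 'y) measure) \<Rightarrow> ('x, 'y) dataset \<Rightarrow> 'x \<times> 'y \<Rightarrow> real" where
  "acc A S z = \<P>(h in A S. h (fst z) = snd z)"

text \<open>Examples are numbered from \<open>0\<close>, as in the list library. For a set \<open>I\<close> of indices,
  \<open>nths S I\<close> is the subsequence \<open>S\<^sub>I\<close>.\<close>

definition infl :: "(('x, 'y) dataset \<Rightarrow> ('x \<Rightarrow> 'y) measure) \<Rightarrow> ('x, 'y) dataset \<Rightarrow> nat \<Rightarrow> 'x \<times> 'y \<Rightarrow> real" where
  "infl A S i z = acc A S z - acc A (nths S (- {i})) z"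

text \<open>Meant for finite \<open>J\<close> and \<open>k \<le> card J\<close>.\<close>

definition subset_pmf :: "nat set \<Rightarrow> nat \<Rightarrow> nat set pmf" where
  "subset_pmf J k = pmf_of_set {I. I \<subseteq> J \<and> card I = k}"

text \<open>Passing from \<open>S\<close> to \<open>nths S (insert i I)\<close> renumbers the examples: the one that had index
  \<open>i\<close> in \<open>S\<close> has index \<open>card {j \<in> I. j < i}\<close> in the subsequence.\<close>

definition infl_sub ::
  "nat \<Rightarrow> (('x, 'y) dataset \<Rightarrow> ('x \<Rightarrow> 'y) measure) \<Rightarrow> ('x, 'y) dataset \<Rightarrow> nat \<Rightarrow> 'x \<times> 'y \<Rightarrow> real" where
  "infl_sub m A S i z =
     measure_pmf.expectation (subset_pmf ({..<length S} - {i}) (m - 1))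
       (\<lambda>I. infl A (nths S (insert i I)) (card {j \<in> I. j < i}) z)"

lemma nths_insert_split:
  fixes S :: "'a list"
  assumes "i < length S" "i \<notin> I"
  shows "nths S (insert i I) ! card {j \<in> I. j < i} = S ! i"
    and "nths (nths S (insert i I)) (- {card {j \<in> I. j < i}}) = nths S I"
proof -
  define B where "B = nths (drop (Suc i) S) {j. Suc (j + i) \<in> I}"
  define F where "F = nths (take i S) I"
  have S: "S = take i S @ S ! i # drop (Suc i) S"
    using assms(1) by (rule id_take_nth_drop)
  have ins: "nths (take i S) (insert i I) = F"
    unfolding F_def nths_def
    by (intro arg_cong[where f = "map fst"] filter_cong refl)
       (auto simp: set_zip)
  have len: "length (take i S) = i" using assms(1) by simp
  have 1: "nths S (insert i I) = F @ S ! i # B"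
    by (subst S) (use assms(2) in \<open>simp add: nths_append nths_Cons ins len B_def min_absorb2 less_imp_le[OF assms(1)]\<close>)
  have 2: "nths S I = F @ B"
    by (subst S) (use assms(2) in \<open>simp add: nths_append nths_Cons F_def len B_def min_absorb2 less_imp_le[OF assms(1)]\<close>)
  have lenF: "length F = card {j \<in> I. j < i}"
    using assms(1) by (simp add: F_def length_nths conj_commute)
  show "nths S (insert i I) ! card {j \<in> I. j < i} = S ! i"
    by (simp add: 1 lenF[symmetric])
  have "nths F (- {length F}) = F" by (rule nths_all) auto
  moreover have "nths B {j. Suc (j + length F) \<noteq> length F} = B" by (rule nths_all) auto
  ultimately show "nths (nths S (insert i I)) (- {card {j \<in> I. j < i}}) = nths S I"
    by (simp add: 1 2 lenF[symmetric] nths_append nths_Cons)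
qed


section \<open>Estimation algorithms\<close>

text \<open>What an estimation algorithm does on a given input. It draws \<open>c\<close> from \<open>coins\<close>, runs the learner
  on the datasets \<open>train c 0, \<dots>, train c (t - 1)\<close>, evaluates the \<open>j\<close>-th resulting model at the
  points in \<open>probes c j\<close>, and computes all its estimates from \<open>c\<close> and the list of the \<open>t\<close> lists
  of labels obtained in this way. The learner enters in no other way.\<close>

datatype ('x, 'y) strategy = Strategy
  (coins: "nat pmf")
  (train: "nat \<Rightarrow> nat \<Rightarrow> ('x, 'y) dataset")
  (probes: "nat \<Rightarrow> nat \<Rightarrow> 'x list")
  (guess: "nat \<Rightarrow> 'y list list \<Rightarrow> nat \<Rightarrow> real")

definition estimates :: "('x, 'y) strategy \<Rightarrow> nat \<Rightarrow> nat \<Rightarrow> (nat \<Rightarrow> 'x \<Rightarrow> 'y) \<Rightarrow> nat \<Rightarrow> real" where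
  "estimates P t c h = guess P c (map (\<lambda>j. map (h j) (probes P c j)) [0..<t])"

text \<open>The arguments are \<open>S\<close>, \<open>z\<close>, \<open>m\<close> and \<open>t\<close>.\<close>

type_synonym ('x, 'y) estimator =
  "('x, 'y) dataset \<Rightarrow> 'x \<times> 'y \<Rightarrow> nat \<Rightarrow> nat \<Rightarrow> ('x, 'y) strategy"

text \<open>The estimates must be random variables; otherwise their law below would be meaningless.\<close>

definition estimation_algorithm :: "('x, 'y) estimator \<Rightarrow> bool" where
  "estimation_algorithm E \<longleftrightarrow>
     (\<forall>S z m t c i. (\<lambda>h. estimates (E S z m t) t c h i)
        \<in> borel_measurable (Pi\<^sub>M {..<t} (\<lambda>_. model_space)))"

text \<open>The joint law of the estimates \<open>(\<mu>\<^sub>0, \<dots>, \<mu>\<^sub>n\<^sub>-\<^sub>1)\<close>. Given the coins,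
  the \<open>t\<close> runs of the learner are independent.\<close>

definition estimates_law ::
  "('x, 'y) strategy \<Rightarrow> (('x, 'y) dataset \<Rightarrow> ('x \<Rightarrow> 'y) measure) \<Rightarrow> nat \<Rightarrow> nat \<Rightarrow> (nat \<Rightarrow> real) measure" where
  "estimates_law P A t n =
     measure_pmf (coins P) \<bind> (\<lambda>c.
       distr (Pi\<^sub>M {..<t} (\<lambda>j. A (train P c j))) (Pi\<^sub>M {..<n} (\<lambda>_. borel))
         (\<lambda>h. \<lambda>i\<in>{..<n}. estimates P t c h i))"

lemma estimates_kernel:
  assumes "estimation_algorithm E" "learning_algorithm A"
  and P_def: "P = E S z m t"
  shows "(\<lambda>h. \<lambda>i\<in>{..<n}. estimates P t c h i)
           \<in> Pi\<^sub>M {..<t} (\<lambda>j. A (train P c j)) \<rightarrow>\<^sub>M Pi\<^sub>M {..<n} (\<lambda>_. borel)"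
    and "(\<lambda>c. distr (Pi\<^sub>M {..<t} (\<lambda>j. A (train P c j))) (Pi\<^sub>M {..<n} (\<lambda>_. borel))
            (\<lambda>h. \<lambda>i\<in>{..<n}. estimates P t c h i))
           \<in> measure_pmf q \<rightarrow>\<^sub>M prob_algebra (Pi\<^sub>M {..<n} (\<lambda>_. borel))"
proof -
  have s: "sets (Pi\<^sub>M {..<t} (\<lambda>j. A (train P c j))) = sets (Pi\<^sub>M {..<t} (\<lambda>_. model_space))" for c
    using assms(2) by (intro sets_PiM_cong) (auto simp: learning_algorithm_def)
  have meas: "(\<lambda>h. \<lambda>i\<in>{..<n}. estimates P t c h i)
           \<in> Pi\<^sub>M {..<t} (\<lambda>j. A (train P c j)) \<rightarrow>\<^sub>M Pi\<^sub>M {..<n} (\<lambda>_. borel)" for c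
  proof (subst measurable_cong_sets[OF s refl], rule measurable_restrict)
    show "(\<lambda>h. estimates P t c h i) \<in> borel_measurable (Pi\<^sub>M {..<t} (\<lambda>_. model_space))" for i
      using assms(1) unfolding estimation_algorithm_def P_def by blast
  qed
  show "(\<lambda>h. \<lambda>i\<in>{..<n}. estimates P t c h i)
           \<in> Pi\<^sub>M {..<t} (\<lambda>j. A (train P c j)) \<rightarrow>\<^sub>M Pi\<^sub>M {..<n} (\<lambda>_. borel)"
    by (rule meas)
  have "prob_space (Pi\<^sub>M {..<t} (\<lambda>j. A (train P c j)))" for c
    using assms(2) by (intro prob_space_PiM) (auto simp: learning_algorithm_def)
  then show "(\<lambda>c. distr (Pi\<^sub>M {..<t} (\<lambda>j. A (train P c j))) (Pi\<^sub>M {..<n} (\<lambda>_. borel))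
            (\<lambda>h. \<lambda>i\<in>{..<n}. estimates P t c h i))
           \<in> measure_pmf q \<rightarrow>\<^sub>M prob_algebra (Pi\<^sub>M {..<n} (\<lambda>_. borel))"
    by (auto simp: space_prob_algebra intro!: prob_space.prob_space_distr meas)
qed

lemma prob_space_estimates_law:
  assumes "estimation_algorithm E" "learning_algorithm A"
  shows "prob_space (estimates_law (E S z m t) A t n)"
  unfolding estimates_law_def
  by (rule prob_space_bind'[OF _ estimates_kernel(2)[OF assms refl]])
     (auto simp: space_prob_algebra prob_space_measure_pmf)

end

theory Submission
  imports Defs
begin

text \<open>Number the examples \<open>0, \<dots>, n - 1\<close> and let every run use an independent, uniformly random \<open>m\<close>-subset
  \<open>J\<close> of \<open>{0, \<dots>, n}\<close>. The extra index \<open>n\<close> is a dummy that selects no example, so \<open>J\<close> yields \<open>m\<close>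
  examples if \<open>n \<notin> J\<close> and \<open>m - 1\<close> otherwise. Exchanging \<open>i\<close> and \<open>n\<close> shows that the events
  \<open>i \<in> J, n \<notin> J\<close> and \<open>n \<in> J, i \<notin> J\<close> have the same probability \<open>w = m (n + 1 - m) / (n (n + 1))\<close>, and
  \<open>J - {i}\<close> and \<open>J - {n}\<close> are then uniform \<open>(m - 1)\<close>-subsets of the other examples. Hence
  \<open>\<plusminus>(1[h x = y] - 1/2) / w\<close>, with sign \<open>+\<close> on the first event, \<open>-\<close> on the second and value \<open>0\<close>
  elsewhere, is an unbiased estimate of the subsampled influence with second moment \<open>1 / (2 w)\<close>.
  The mean of \<open>t\<close> such estimates has mean square error at most
  \<open>1 / (2 w t) \<le> n\<^sup>2 / (m (n - m) t) = 1 / (p t) + 1 / ((1 - p) t)\<close>.\<close>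

section \<open>Coding a random object by a natural number\<close>

text \<open>The coins of a strategy are natural numbers, whereas the estimator draws a family of
  index sets. The support of a \<open>pmf\<close> is countable, so \<open>to_nat_on\<close> is
  injective on it and \<open>from_nat_into\<close> recovers the draw.\<close>

definition nat_coded_pmf :: "'c pmf \<Rightarrow> nat pmf" where
  "nat_coded_pmf q = map_pmf (to_nat_on (set_pmf q)) q"

lemma map_nat_coded_pmf: "map_pmf (from_nat_into (set_pmf q)) (nat_coded_pmf q) = q"
  unfolding nat_coded_pmf_def map_pmf_comp
  by (rule map_pmf_idI) simp

section \<open>Mean square error of an average over independent runs\<close>

text \<open>Put the constant factor 1 on every other coordinate and apply the product formula over
  all of \<open>I\<close>; the extra integrals equal 1 because each factor is a probability
  space.\<close>

lemma (in product_prob_space) integral_PiM_mult: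
  fixes f g :: "'a \<Rightarrow> real"
  assumes I: "finite I" "j \<in> I" "k \<in> I" "j \<noteq> k"
    and f: "integrable (M j) f" and g: "integrable (M k) g"
  shows "(\<integral>x. f (x j) * g (x k) \<partial>Pi\<^sub>M I M) = integral\<^sup>L (M j) f * integral\<^sup>L (M k) g"
    (is "?L = ?R")
proof -
  define F where "F l = (if l = j then f else if l = k then g else (\<lambda>_. 1))" for l
  have split: "prod G I = G j * G k" if "\<And>l. l \<in> I - {j, k} \<Longrightarrow> G l = 1" for G :: "'i \<Rightarrow> real"
    using I prod.mono_neutral_right[of I "{j, k}" G] that by auto
  have "?L = (\<integral>x. (\<Prod>l\<in>I. F l (x l)) \<partial>Pi\<^sub>M I M)"
    using I(4) by (intro Bochner_Integration.integral_cong refl, subst split) (auto simp: F_def)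
  also have "\<dots> = (\<Prod>l\<in>I. integral\<^sup>L (M l) (F l))"
    using I f g by (intro product_integral_prod) (auto simp: F_def)
  also have "\<dots> = ?R"
    using I(4) by (subst split) (auto simp: F_def M.prob_space)
  finally show ?thesis .
qed

text \<open>The analogue for the coins: distinct coordinates of \<open>Pi_pmf\<close> are
  independent, and finite support gives integrability of arbitrary \<open>f\<close> and
  \<open>g\<close>.\<close>

lemma expectation_Pi_pmf_mult:
  fixes f g :: "'c \<Rightarrow> real"
  assumes "finite I" "j \<in> I" "k \<in> I" "j \<noteq> k" and q: "finite (set_pmf q)"
  shows "measure_pmf.expectation (Pi_pmf I d (\<lambda>_. q)) (\<lambda>c. f (c j) * g (c k))
    = measure_pmf.expectation q f * measure_pmf.expectation q g"
proof -
  have comp: "map_pmf (\<lambda>c. c l) (Pi_pmf I d (\<lambda>_. q)) = q" if "l \<in> I" for l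
    using that assms by (simp add: Pi_pmf_component)
  let ?P = "Pi_pmf I d (\<lambda>_. q)"
  define F where "F l = (if l = j then f else g)" for l
  have E: "measure_pmf.expectation ?P (\<lambda>c. h (c l)) = measure_pmf.expectation q h" if "l \<in> I"
    for l and h :: "'c \<Rightarrow> real"
    using integral_map_pmf[of "\<lambda>c. c l" ?P h] comp[OF that] by simp
  have fin: "finite (set_pmf ?P)"
    using assms(1) q by (simp add: set_Pi_pmf finite_PiE_dflt)
  have ind: "prob_space.indep_vars (measure_pmf ?P) (\<lambda>_. borel) (\<lambda>l c. F l (c l)) {j, k}"
    using assms by (intro prob_space.indep_vars_compose2[OF measure_pmf.prob_space_axioms
        prob_space.indep_vars_subset[OF measure_pmf.prob_space_axioms indep_vars_Pi_pmf]]) auto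
  have "measure_pmf.expectation ?P (\<lambda>c. \<Prod>l\<in>{j, k}. F l (c l))
      = (\<Prod>l\<in>{j, k}. measure_pmf.expectation ?P (\<lambda>c. F l (c l)))"
    using fin by (intro prob_space.indep_vars_lebesgue_integral[OF measure_pmf.prob_space_axioms _ ind])
      (auto intro: integrable_measure_pmf_finite)
  then show ?thesis
    using assms by (simp add: F_def E)
qed

text \<open>A run has two layers of randomness: \<open>c j\<close> drawn from \<open>q\<close>, then
  \<open>h j\<close> drawn from \<open>M (c j)\<close>. Given the coins, the error of a run need not
  have mean 0, so cross terms survive the inner integral as products of conditional means. They
  vanish only in the outer expectation, which leaves the variance of one run divided by
  \<open>t\<close>.\<close>

lemma mean_square_error_le:
  fixes X :: "'c \<Rightarrow> 'b \<Rightarrow> real"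
  assumes q: "finite (set_pmf q)" and M: "\<And>c. prob_space (M c)"
    and X: "\<And>c. X c \<in> borel_measurable (M c)" and B: "\<And>c h. \<bar>X c h\<bar> \<le> B" and t: "t \<ge> 1"
    and \<theta>: "\<theta> = measure_pmf.expectation q (\<lambda>c. \<integral>h. X c h \<partial>M c)"
  shows "(\<integral>\<^sup>+ c. \<integral>\<^sup>+ h. ennreal ((\<theta> - (\<Sum>j<t. X (c j) (h j)) / real t)\<^sup>2) \<partial>Pi\<^sub>M {..<t} (\<lambda>j. M (c j))
            \<partial>Pi_pmf {..<t} d (\<lambda>_. q))
         \<le> ennreal (measure_pmf.expectation q (\<lambda>c. \<integral>h. (X c h)\<^sup>2 \<partial>M c) / real t)"
proof -
  let ?P = "Pi_pmf {..<t} d (\<lambda>_. q)"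
  \<comment> \<open>\<open>Y\<close> is the error of a single run; \<open>f\<close> and
    \<open>s\<close> are its conditional mean and second moment given the coin
    \<open>c\<close>.\<close>
  define Y where "Y c h = X c h - \<theta>" for c h
  define f where "f c = (\<integral>h. Y c h \<partial>M c)" for c
  define s where "s c = (\<integral>h. (Y c h)\<^sup>2 \<partial>M c)" for c
  have Yb: "\<bar>Y c h\<bar> \<le> B + \<bar>\<theta>\<bar>" for c h
    using B[of c h] unfolding Y_def by linarith
  have Ym [measurable]: "Y c \<in> borel_measurable (M c)" for c
    using X[of c] unfolding Y_def by simp
  note Xm [measurable] = X
  have finint: "integrable (M c) g" if "g \<in> borel_measurable (M c)" "\<And>h. \<bar>g h\<bar> \<le> K"
    for c K and g :: "'b \<Rightarrow> real"
  proof -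
    interpret prob_space "M c" by (rule M)
    show ?thesis using that by (intro integrable_const_bound[of _ K]) auto
  qed
  have Xi: "integrable (M c) (X c)" for c using finint[OF X B] .
  have X2i: "integrable (M c) (\<lambda>h. (X c h)\<^sup>2)" for c
    by (rule finint[of _ _ "B\<^sup>2"])
      (use B in \<open>auto simp: abs_le_square_iff[symmetric] intro: order_trans[OF _ abs_ge_self]\<close>)
  have Yi: "integrable (M c) (Y c)" for c using finint[OF Ym Yb] .
  have fc: "f c = (\<integral>h. X c h \<partial>M c) - \<theta>" for c
  proof -
    interpret prob_space "M c" by (rule M)
    show ?thesis unfolding f_def Y_def using Xi by (simp add: prob_space)
  qed
  have Ef: "measure_pmf.expectation q f = 0"
    unfolding fc using q by (simp add: integrable_measure_pmf_finite \<theta>)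
  have sc: "s c = (\<integral>h. (X c h)\<^sup>2 \<partial>M c) - 2 * \<theta> * (\<integral>h. X c h \<partial>M c) + \<theta>\<^sup>2" for c
  proof -
    interpret prob_space "M c" by (rule M)
    show ?thesis unfolding s_def Y_def using Xi X2i by (simp add: prob_space power2_diff mult_ac)
  qed
  \<comment> \<open>Averaging \<open>sc\<close> over \<open>q\<close> gives the second moment of
    \<open>X\<close> minus \<theta> squared: a variance is at most the second moment.\<close>
  have Es: "measure_pmf.expectation q s \<le> measure_pmf.expectation q (\<lambda>c. \<integral>h. (X c h)\<^sup>2 \<partial>M c)"
    unfolding sc using q
    by (simp add: integrable_measure_pmf_finite \<theta>[symmetric] power2_eq_square)
  have inner: "(\<integral>\<^sup>+ h. ennreal ((\<theta> - (\<Sum>j<t. X (c j) (h j)) / real t)\<^sup>2) \<partial>Pi\<^sub>M {..<t} (\<lambda>j. M (c j)))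
      = ennreal ((\<Sum>j<t. \<Sum>k<t. if j = k then s (c j) else f (c j) * f (c k)) / (real t)\<^sup>2)"
    (is "?L = ennreal ?R")
    and nonneg: "(\<Sum>j<t. \<Sum>k<t. if j = k then s (c j) else f (c j) * f (c k)) / (real t)\<^sup>2 \<ge> 0"
    for c
  proof -
    interpret product_prob_space "\<lambda>j. M (c j)" "{..<t}" by (intro product_prob_spaceI M)
    let ?N = "Pi\<^sub>M {..<t} (\<lambda>j. M (c j))"
    have sq: "(\<theta> - (\<Sum>j<t. X (c j) (h j)) / real t)\<^sup>2
        = (\<Sum>j<t. \<Sum>k<t. Y (c j) (h j) * Y (c k) (h k)) / (real t)\<^sup>2" for h
    proof -
      have "\<theta> - (\<Sum>j<t. X (c j) (h j)) / real t = - (\<Sum>j<t. Y (c j) (h j)) / real t"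
        using t by (simp add: Y_def sum_subtractf field_simps)
      then show ?thesis
        by (simp add: power_divide power2_eq_square sum_product)
    qed
    have int: "integrable ?N (\<lambda>h. Y (c j) (h j) * Y (c k) (h k))" if "j < t" "k < t" for j k
      using that
      by (intro P.integrable_const_bound[of _ "(B + \<bar>\<theta>\<bar>) * (B + \<bar>\<theta>\<bar>)"])
         (auto simp: abs_mult intro!: mult_mono Yb order_trans[OF abs_ge_zero Yb])
    have cross: "(\<integral>h. Y (c j) (h j) * Y (c k) (h k) \<partial>?N) = (if j = k then s (c j) else f (c j) * f (c k))"
      if "j < t" "k < t" for j k
    proof (cases "j = k")
      case True
      have "(\<integral>h. (Y (c j) h)\<^sup>2 \<partial>distr ?N (M (c j)) (\<lambda>h. h j)) = s (c j)"
        using that M by (subst distr_PiM_component) (auto simp: s_def)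
      then show ?thesis
        using True that by (subst (asm) integral_distr) (auto simp: power2_eq_square)
    next
      case False
      then show ?thesis
        using that by (subst integral_PiM_mult) (auto simp: Yi f_def)
    qed
    have R: "(\<integral>h. (\<Sum>j<t. \<Sum>k<t. Y (c j) (h j) * Y (c k) (h k)) / (real t)\<^sup>2 \<partial>?N) = ?R"
    proof -
      have "(\<integral>h. (\<Sum>j<t. \<Sum>k<t. Y (c j) (h j) * Y (c k) (h k)) \<partial>?N)
          = (\<Sum>j<t. \<integral>h. (\<Sum>k<t. Y (c j) (h j) * Y (c k) (h k)) \<partial>?N)"
        by (intro Bochner_Integration.integral_sum Bochner_Integration.integrable_sum int) auto
      also have "\<dots> = (\<Sum>j<t. \<Sum>k<t. if j = k then s (c j) else f (c j) * f (c k))"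
        by (intro sum.cong refl, subst Bochner_Integration.integral_sum) (auto simp: int cross simp del: if_split)
      finally show ?thesis by simp
    qed
    \<comment> \<open>The double sum is the square of a single sum. Its sign permits passing from
      the nonnegative integral to the Bochner integral.\<close>
    have sum_nonneg: "(\<Sum>j<t. \<Sum>k<t. Y (c j) (h j) * Y (c k) (h k)) \<ge> 0" for h
      by (simp add: sum_product[symmetric])
    show "?R \<ge> 0"
      unfolding R[symmetric]
      by (intro Bochner_Integration.integral_nonneg divide_nonneg_nonneg sum_nonneg zero_le_power2)
    show "?L = ennreal ?R"
      unfolding sq R[symmetric]
      by (intro nn_integral_eq_integral integrable_divide Bochner_Integration.integrable_sum int AE_I2
          divide_nonneg_nonneg sum_nonneg zero_le_power2) simp_all
  qed
  have finP: "finite (set_pmf ?P)"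
    using q by (simp add: set_Pi_pmf finite_PiE_dflt)
  have integP: "integrable (measure_pmf ?P) g" for g :: "_ \<Rightarrow> real"
    using finP by (rule integrable_measure_pmf_finite)
  have comp: "measure_pmf.expectation ?P (\<lambda>c. g (c l)) = measure_pmf.expectation q g" if "l < t"
    for l and g :: "'c \<Rightarrow> real"
    using integral_map_pmf[of "\<lambda>c. c l" ?P g] that by (simp add: Pi_pmf_component)
  have "(\<integral>\<^sup>+ c. \<integral>\<^sup>+ h. ennreal ((\<theta> - (\<Sum>j<t. X (c j) (h j)) / real t)\<^sup>2) \<partial>Pi\<^sub>M {..<t} (\<lambda>j. M (c j)) \<partial>?P)
      = ennreal (measure_pmf.expectation ?P
          (\<lambda>c. (\<Sum>j<t. \<Sum>k<t. if j = k then s (c j) else f (c j) * f (c k)) / (real t)\<^sup>2))"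
    unfolding inner by (intro nn_integral_eq_integral integP) (auto simp: nonneg)
  \<comment> \<open>Off the diagonal, independence gives the square of the mean of \<open>f\<close>,
    which is 0 by \<open>Ef\<close>.\<close>
  also have "measure_pmf.expectation ?P
          (\<lambda>c. (\<Sum>j<t. \<Sum>k<t. if j = k then s (c j) else f (c j) * f (c k)) / (real t)\<^sup>2)
     = (\<Sum>j<t. \<Sum>k<t. if j = k then measure_pmf.expectation q s else 0) / (real t)\<^sup>2"
  proof -
    have "measure_pmf.expectation ?P (\<lambda>c. if j = k then s (c j) else f (c j) * f (c k))
        = (if j = k then measure_pmf.expectation q s else 0)" if "j < t" "k < t" for j k
      using that q comp[of j s] expectation_Pi_pmf_mult[of "{..<t}" j k q d f f] Ef by auto
    then show ?thesis
      by (simp add: Bochner_Integration.integral_sum integP cong: sum.cong_simp)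
  qed
  also have "\<dots> = measure_pmf.expectation q s / real t"
    using t by (simp add: power2_eq_square)
  finally show ?thesis
    using Es by (auto intro!: ennreal_leI divide_right_mono)
qed


section \<open>Subsets with a dummy index, and binomial identities\<close>

text \<open>Positions in \<open>S\<close> stop at \<open>length S - 1\<close>, so
  \<open>length S\<close> can serve as the dummy index.\<close>

lemma nths_insert_length: "nths S (insert (length S) I) = nths S I"
  unfolding nths_def
  by (intro arg_cong[where f = "map fst"] filter_cong refl) (auto simp: set_zip)

text \<open>Deleting \<open>a\<close> is a bijection with inverse \<open>insert a\<close>. The
  resulting index family is symmetric in \<open>a\<close> and \<open>b\<close>, so exchanging them
  gives sums that can be compared term by term.\<close>

lemma sum_subsets_containing:
  fixes F :: "'c set \<Rightarrow> real"
  assumes "finite U" "a \<in> U" "a \<noteq> b" "m \<ge> 1"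
  shows "(\<Sum>J | J \<subseteq> U \<and> card J = m. of_bool (a \<in> J \<and> b \<notin> J) * F J)
       = (\<Sum>I | I \<subseteq> U - {a, b} \<and> card I = m - 1. F (insert a I))"
proof -
  have "(\<Sum>J | J \<subseteq> U \<and> card J = m. of_bool (a \<in> J \<and> b \<notin> J) * F J)
      = (\<Sum>J | J \<subseteq> U \<and> card J = m \<and> a \<in> J \<and> b \<notin> J. F J)"
    using assms(1) by (intro sum.mono_neutral_cong_right) auto
  also have "\<dots> = (\<Sum>I | I \<subseteq> U - {a, b} \<and> card I = m - 1. F (insert a I))"
  proof (rule sum.reindex_bij_witness[of _ "insert a" "\<lambda>J. J - {a}"])
    fix I assume I: "I \<in> {I. I \<subseteq> U - {a, b} \<and> card I = m - 1}"
    then have "finite I" using assms(1) by (auto intro: finite_subset)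
    then have "card (insert a I) = m"
      using I assms(4) by (subst card_insert_disjoint) auto
    then show "insert a I \<in> {J. J \<subseteq> U \<and> card J = m \<and> a \<in> J \<and> b \<notin> J}"
      using I assms by auto
    show "insert a I - {a} = I" using I by auto
  qed (auto simp: insert_absorb)
  finally show ?thesis .
qed

text \<open>Two absorption identities, with \<open>m = k + 1\<close>, lower first both arguments and
  then the upper one. This yields the closed form of the probability \<open>w\<close>.\<close>

lemma choose_Suc_ratio:
  assumes "1 \<le> m" "m \<le> n"
  shows "m * (n + 1 - m) * ((n + 1) choose m) = n * (n + 1) * ((n - 1) choose (m - 1))"
proof -
  obtain k where m: "m = Suc k" using assms by (cases m) auto
  obtain l where n: "n = Suc l" using assms by (cases n) auto
  have 1: "Suc k * (Suc n choose Suc k) = Suc n * (n choose k)"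
    by (rule Suc_times_binomial)
  have 2: "(n - k) * (n choose k) = n * ((n - 1) choose k)"
    by (rule binomial_absorb_comp)
  have "m * (n + 1 - m) * ((n + 1) choose m) = (n - k) * (Suc k * (Suc n choose Suc k))"
    by (simp add: m ac_simps del: binomial_Suc_Suc mult_Suc mult_Suc_right)
  also have "\<dots> = Suc n * ((n - k) * (n choose k))"
    unfolding 1 by (simp only: ac_simps)
  finally show ?thesis
    unfolding 2 by (simp add: m ac_simps del: binomial_Suc_Suc mult_Suc mult_Suc_right)
qed

section \<open>The estimator and its measurability\<close>

definition draws :: "nat \<Rightarrow> nat \<Rightarrow> nat set set" where
  "draws n m = {J. J \<subseteq> {..n} \<and> card J = m}"

text \<open>The probability \<open>w\<close>, as a quotient of binomial coefficients.\<close>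

definition weight :: "nat \<Rightarrow> nat \<Rightarrow> real" where
  "weight n m = real ((n - 1) choose (m - 1)) / real ((n + 1) choose m)"

text \<open>The shift by 1/2 cancels in the mean, since the signs + and - are equally likely, and it
  makes the square on either event independent of the predicted label.\<close>

definition score :: "nat \<Rightarrow> nat \<Rightarrow> nat \<Rightarrow> 'x \<times> 'y \<Rightarrow> nat set \<Rightarrow> ('x \<Rightarrow> 'y) \<Rightarrow> real" where
  "score n m i z J h =
     (of_bool (i \<in> J \<and> n \<notin> J) - of_bool (n \<in> J \<and> i \<notin> J)) / weight n m
       * (of_bool (h (fst z) = snd z) - 1 / 2)"

definition draws_pmf :: "nat \<Rightarrow> nat \<Rightarrow> nat \<Rightarrow> (nat \<Rightarrow> nat set) pmf" where
  "draws_pmf n m t = Pi_pmf {..<t} {} (\<lambda>_. pmf_of_set (draws n m))"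

text \<open>One coin encodes all \<open>t\<close> index sets, and the training sets do not depend on
  \<open>i\<close>, so the same runs serve every estimate. As \<open>score\<close> reads a model
  only at \<open>fst z\<close>, the constant function with the observed label can replace the
  model.\<close>

definition influence_estimator :: "('x, 'y) estimator" where
  "influence_estimator S z m t =
     (let n = length S; Q = draws_pmf n m t; J = from_nat_into (set_pmf Q) in
      Strategy (nat_coded_pmf Q) (\<lambda>c j. nths S (J c j)) (\<lambda>_ _. [fst z])
        (\<lambda>c ys i. (\<Sum>j<t. score n m i z (J c j) (\<lambda>_. hd (ys ! j))) / real t))"

lemma estimates_influence_estimator:
  "estimates (influence_estimator S z m t) t c h i
    = (\<Sum>j<t. score (length S) m i z (from_nat_into (set_pmf (draws_pmf (length S) m t)) c j) (h j)) / real t"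
  by (simp add: estimates_def influence_estimator_def Let_def score_def)

lemma space_model_space: "space model_space = UNIV"
  by (simp add: model_space_def space_measure_of_conv)

lemma sets_model_space_event: "{h. h x = y} \<in> sets model_space"
  unfolding model_space_def by auto

lemma measurable_score [measurable]: "score n m i z J \<in> borel_measurable model_space"
proof -
  have [measurable]: "Measurable.pred model_space (\<lambda>h. h (fst z) = snd z)"
    by (simp add: pred_def space_model_space sets_model_space_event)
  show ?thesis unfolding score_def of_bool_def by measurable
qed

lemma estimation_algorithm_influence_estimator: "estimation_algorithm influence_estimator"
  unfolding estimation_algorithm_def estimates_influence_estimator by measurable

section \<open>Mean and second moment of a single score\<close>

context
  fixes n m i :: nat
  assumes m: "m \<in> {1..n}" and i: "i < n"
begin

lemma draws_finite_nonempty_card: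
  "finite (draws n m)" "draws n m \<noteq> {}" "card (draws n m) = (n + 1) choose m"
proof -
  show "finite (draws n m)" by (simp add: draws_def)
  show "card (draws n m) = (n + 1) choose m"
    using n_subsets[of "{..n}" m] by (simp add: draws_def)
  then show "draws n m \<noteq> {}"
    using m by (metis atLeastAtMost_iff card.empty binomial_eq_0_iff le_add1 le_trans not_less)
qed

lemma card_subsets_avoiding: "card {I. I \<subseteq> {..<n} - {i} \<and> card I = m - 1} = (n - 1) choose (m - 1)"
  using n_subsets[of "{..<n} - {i}" "m - 1"] i by simp

lemma binomials_pos: "(n - 1) choose (m - 1) > 0" "(n + 1) choose m > 0"
  using m by auto

lemma weight_pos: "weight n m > 0"
  using binomials_pos by (simp add: weight_def)

text \<open>Both signed events are parametrised by the same sets \<open>I\<close>, which puts the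
  runs with and without example \<open>i\<close> in correspondence.\<close>

lemma sum_draws:
  fixes F :: "nat set \<Rightarrow> real"
  shows "(\<Sum>J\<in>draws n m. of_bool (i \<in> J \<and> n \<notin> J) * F J)
       = (\<Sum>I | I \<subseteq> {..<n} - {i} \<and> card I = m - 1. F (insert i I))"
    and "(\<Sum>J\<in>draws n m. of_bool (n \<in> J \<and> i \<notin> J) * F J)
       = (\<Sum>I | I \<subseteq> {..<n} - {i} \<and> card I = m - 1. F (insert n I))"
proof -
  have *: "{..n} - {i, n} = {..<n} - {i}" "{..n} - {n, i} = {..<n} - {i}" by auto
  show "(\<Sum>J\<in>draws n m. of_bool (i \<in> J \<and> n \<notin> J) * F J)
       = (\<Sum>I | I \<subseteq> {..<n} - {i} \<and> card I = m - 1. F (insert i I))"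
    using sum_subsets_containing[of "{..n}" i n m F] i m unfolding * by (simp add: draws_def)
  show "(\<Sum>J\<in>draws n m. of_bool (n \<in> J \<and> i \<notin> J) * F J)
       = (\<Sum>I | I \<subseteq> {..<n} - {i} \<and> card I = m - 1. F (insert n I))"
    using sum_subsets_containing[of "{..n}" n i m F] i m unfolding * by (simp add: draws_def)
qed

text \<open>For each \<open>I\<close>, the draw \<open>insert i I\<close> trains with example
  \<open>i\<close> and \<open>insert n I\<close> trains on \<open>nths S I\<close> alone, so their
  contributions combine to one influence term.\<close>

lemma expectation_score:
  assumes A: "learning_algorithm A" and S: "length S = n"
  shows "measure_pmf.expectation (pmf_of_set (draws n m)) (\<lambda>J. \<integral>h. score n m i z J h \<partial>A (nths S J))
    = infl_sub m A S i z"
proof -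
  let ?C = "{I. I \<subseteq> {..<n} - {i} \<and> card I = m - 1}"
  let ?g = "\<lambda>J. (acc A (nths S J) z - 1 / 2) / weight n m"
  have int: "(\<integral>h. score n m i z J h \<partial>A (nths S J))
     = of_bool (i \<in> J \<and> n \<notin> J) * ?g J - of_bool (n \<in> J \<and> i \<notin> J) * ?g J" for J
  proof -
    interpret prob_space "A (nths S J)" using A by (simp add: learning_algorithm_def)
    have sets: "sets (A (nths S J)) = sets model_space" using A by (simp add: learning_algorithm_def)
    have space: "space (A (nths S J)) = UNIV"
      using sets_eq_imp_space_eq[OF sets] by (simp add: space_model_space)
    have ev: "{h. h (fst z) = snd z} \<in> sets (A (nths S J))"
      unfolding sets by (rule sets_model_space_event)
    then have "integrable (A (nths S J)) (indicat_real {h. h (fst z) = snd z})"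
      by (intro integrable_real_indicator) (auto simp: less_top[symmetric])
    note ev = ev this
    have "(\<integral>h. of_bool (h (fst z) = snd z) - 1 / 2 \<partial>A (nths S J))
       = (\<integral>h. indicator {h. h (fst z) = snd z} h - 1 / 2 \<partial>A (nths S J))"
      by (simp add: indicator_def)
    also have "\<dots> = acc A (nths S J) z - 1 / 2"
      using ev by (subst Bochner_Integration.integral_diff) (auto simp: prob_space[unfolded space] acc_def space)
    finally show ?thesis
      unfolding score_def integral_mult_right_zero by (simp add: field_simps)
  qed
  have "(\<Sum>J\<in>draws n m. \<integral>h. score n m i z J h \<partial>A (nths S J))
    = (\<Sum>I\<in>?C. ?g (insert i I) - ?g (insert n I))"
    unfolding int sum_subtractf sum_draws ..
  \<comment> \<open>Here the dummy index \<open>n\<close> disappears from the training set and the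
    two shifts by 1/2 cancel.\<close>
  also have "\<dots> = (\<Sum>I\<in>?C. acc A (nths S (insert i I)) z - acc A (nths S I) z) / weight n m"
    using nths_insert_length[of S] S by (simp add: sum_divide_distrib diff_divide_distrib)
  also have "\<dots> = (\<Sum>I\<in>?C. infl A (nths S (insert i I)) (card {j \<in> I. j < i}) z) / weight n m"
  proof (intro arg_cong[where f = "\<lambda>x. x / _"] sum.cong refl)
    fix I assume "I \<in> ?C"
    then have "i \<notin> I" by auto
    then have "nths (nths S (insert i I)) (- {card {j \<in> I. j < i}}) = nths S I"
      using i S by (intro nths_insert_split(2)) auto
    then show "acc A (nths S (insert i I)) z - acc A (nths S I) z
        = infl A (nths S (insert i I)) (card {j \<in> I. j < i}) z"
      by (simp only: infl_def)
  qed
  finally have sum: "(\<Sum>J\<in>draws n m. \<integral>h. score n m i z J h \<partial>A (nths S J)) = \<dots>" .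
  have "card ?C > 0" unfolding card_subsets_avoiding by (rule binomials_pos(1))
  then have C: "?C \<noteq> {}" "finite ?C" by (auto simp only: card_gt_0_iff)
  have "measure_pmf.expectation (pmf_of_set (draws n m)) (\<lambda>J. \<integral>h. score n m i z J h \<partial>A (nths S J))
    = (\<Sum>I\<in>?C. infl A (nths S (insert i I)) (card {j \<in> I. j < i}) z) / weight n m / card (draws n m)"
    by (simp only: integral_pmf_of_set[OF draws_finite_nonempty_card(2,1)] sum)
  \<comment> \<open>\<open>weight n m\<close> is \<open>card ?C / card (draws n m)\<close>, so
    dividing by it turns the average over draws into the average over \<open>?C\<close>.\<close>
  also have "\<dots> = (\<Sum>I\<in>?C. infl A (nths S (insert i I)) (card {j \<in> I. j < i}) z) / card ?C"
    unfolding weight_def card_subsets_avoiding draws_finite_nonempty_card(3) divide_divide_eq_left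
    using binomials_pos(2) by (simp only: nonzero_divide_mult_cancel_right of_nat_0_less_iff
        times_divide_eq_left nonzero_mult_div_cancel_right of_nat_eq_0_iff neq0_conv not_False_eq_True)
  also have "\<dots> = infl_sub m A S i z"
    unfolding infl_sub_def subset_pmf_def S by (rule integral_pmf_of_set[OF C, symmetric])
  finally show ?thesis .
qed

text \<open>The squared score is \<open>1 / (4 * w^2)\<close> on two disjoint events of probability
  \<open>w\<close> each, where \<open>w\<close> is \<open>weight n m\<close>, and 0
  elsewhere.\<close>

lemma expectation_score_square:
  assumes A: "learning_algorithm A"
  shows "measure_pmf.expectation (pmf_of_set (draws n m)) (\<lambda>J. \<integral>h. (score n m i z J h)\<^sup>2 \<partial>A (nths S J))
    = 1 / (2 * weight n m)"
proof -
  have int: "(\<integral>h. (score n m i z J h)\<^sup>2 \<partial>A (nths S J))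
     = of_bool (i \<in> J \<and> n \<notin> J) * (1 / (4 * (weight n m)\<^sup>2))
        + of_bool (n \<in> J \<and> i \<notin> J) * (1 / (4 * (weight n m)\<^sup>2))" for J
  proof -
    interpret prob_space "A (nths S J)" using A by (simp add: learning_algorithm_def)
    have "(score n m i z J h)\<^sup>2 = of_bool (i \<in> J \<and> n \<notin> J) * (1 / (4 * (weight n m)\<^sup>2))
        + of_bool (n \<in> J \<and> i \<notin> J) * (1 / (4 * (weight n m)\<^sup>2))" for h
      by (auto simp: score_def power2_eq_square of_bool_def)
    then show ?thesis by (simp add: prob_space)
  qed
  show ?thesis
    using draws_finite_nonempty_card binomials_pos
    unfolding integral_pmf_of_set[OF draws_finite_nonempty_card(2,1)] int sum.distrib sum_draws
    by (simp add: card_subsets_avoiding[unfolded One_nat_def] weight_def power2_eq_square field_simps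
        del: binomial_eq_0_iff zero_less_binomial_iff)
qed

lemma weight_bound:
  assumes "m < n"
  shows "1 / (2 * weight n m) \<le> 1 / (real m / real n) + 1 / (1 - real m / real n)"
proof -
  define c where "c = real ((n + 1) choose m)"
  define d where "d = real ((n - 1) choose (m - 1))"
  have "c > 0" "d > 0"
    using binomials_pos unfolding c_def d_def by (simp_all only: of_nat_0_less_iff)
  have "real m * (real n + 1 - real m) * real ((n + 1) choose m)
      = real n * (real n + 1) * real ((n - 1) choose (m - 1))"
  proof -
    have "real (n + 1 - m) = real n + 1 - real m" using m by simp
    moreover have "real (m * (n + 1 - m) * ((n + 1) choose m)) = real (n * (n + 1) * ((n - 1) choose (m - 1)))"
      using m by (intro arg_cong[where f = real] choose_Suc_ratio) auto
    ultimately show ?thesis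
      by (simp only: of_nat_mult of_nat_add of_nat_1)
  qed
  then have "real m * (real n + 1 - real m) * c = real n * (real n + 1) * d"
    unfolding c_def d_def .
  then have "c / d = real n * (real n + 1) / (real m * (real n + 1 - real m))"
    using \<open>c > 0\<close> \<open>d > 0\<close> m assms by (simp add: frac_eq_eq mult_ac)
  moreover have "1 / (2 * (d / c)) = (c / d) / 2"
    by simp
  ultimately have "1 / (2 * (d / c)) = real n * (real n + 1) / (real m * (real n + 1 - real m)) / 2"
    by (simp only:)
  \<comment> \<open>Uses \<open>n + 1\<close> \<le> \<open>2 * n\<close> above and
    \<open>n - m\<close> \<le> \<open>n + 1 - m\<close> below; \<open>m < n\<close> keeps the new
    denominator positive. Partial fractions then finish.\<close>
  also have "\<dots> \<le> real n * (2 * real n) / (real m * (real n - real m)) / 2"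
    using m assms by (intro divide_right_mono frac_le mult_left_mono mult_pos_pos) auto
  also have "\<dots> = 1 / (real m / real n) + 1 / (1 - real m / real n)"
    using m assms by (simp add: field_simps)
  finally show ?thesis unfolding weight_def c_def d_def .
qed

end

section \<open>Error bound for the estimator\<close>

theorem lemma2p1:
  "\<exists>E :: ('x, 'y) estimator. estimation_algorithm E \<and>
     (\<forall>(S :: ('x, 'y) dataset) (A :: ('x, 'y) dataset \<Rightarrow> ('x \<Rightarrow> 'y) measure) (z :: 'x \<times> 'y)
        (m :: nat) (t :: nat) (n :: nat) (i :: nat) (p :: real).
        learning_algorithm A \<longrightarrow> n = length S \<longrightarrow> m \<in> {1..n} \<longrightarrow> t \<ge> 1 \<longrightarrow> i < n \<longrightarrow>
        p = min (real m / real n) (1 - real m / real n) \<longrightarrow>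
        (\<integral>\<^sup>+ \<mu>. ennreal ((infl_sub m A S i z - \<mu> i)\<^sup>2) \<partial>estimates_law (E S z m t) A t n)
          \<le> 1 / ennreal (p * real t) + 1 / ennreal ((1 - p) * real t)
             + ennreal (exp (- p * real t / 16) / 2))"
proof (intro exI[of _ influence_estimator] conjI allI impI estimation_algorithm_influence_estimator)
  fix S :: "('x, 'y) dataset" and A :: "('x, 'y) dataset \<Rightarrow> ('x \<Rightarrow> 'y) measure" and z :: "'x \<times> 'y"
    and m t n i :: nat and p :: real
  assume A: "learning_algorithm A" and n: "n = length S" and m: "m \<in> {1..n}" and t: "t \<ge> 1" and i: "i < n"
    and p: "p = min (real m / real n) (1 - real m / real n)"
  let ?E = "influence_estimator :: ('x, 'y) estimator"
  let ?P = "?E S z m t" and ?\<theta> = "infl_sub m A S i z"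
  let ?rhs = "1 / ennreal (p * real t) + 1 / ennreal ((1 - p) * real t)
             + ennreal (exp (- p * real t / 16) / 2)"
  let ?Q = "draws_pmf n m t"
  let ?dec = "from_nat_into (set_pmf ?Q)"
  note kernel = estimates_kernel[where S = S and z = z and m = m and t = t,
      OF estimation_algorithm_influence_estimator A refl]
  show "(\<integral>\<^sup>+ \<mu>. ennreal ((?\<theta> - \<mu> i)\<^sup>2) \<partial>estimates_law ?P A t n) \<le> ?rhs"
  proof (cases "m = n")
    case True
    \<comment> \<open>In \<open>ennreal\<close>, \<open>1 / 0\<close> is the top element, which
      matches the convention for \<open>p = 0\<close>.\<close>
    then have "p = 0" using p m by simp
    then show ?thesis by simp
  next
    case False
    with m have mn: "m < n" by auto
    have meas: "(\<lambda>\<mu>. ennreal ((?\<theta> - \<mu> i)\<^sup>2)) \<in> borel_measurable (Pi\<^sub>M {..<n} (\<lambda>_. borel))"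
    proof -
      have [measurable]: "(\<lambda>\<mu>. \<mu> i) \<in> borel_measurable (Pi\<^sub>M {..<n} (\<lambda>_. borel))"
        using i by (intro measurable_component_singleton) simp
      show ?thesis by simp
    qed
    have "(\<integral>\<^sup>+ \<mu>. ennreal ((?\<theta> - \<mu> i)\<^sup>2) \<partial>estimates_law ?P A t n)
      = (\<integral>\<^sup>+ c. \<integral>\<^sup>+ h. ennreal ((?\<theta> - estimates ?P t c h i)\<^sup>2) \<partial>Pi\<^sub>M {..<t} (\<lambda>j. A (train ?P c j)) \<partial>coins ?P)"
      unfolding estimates_law_def
      using i by (subst nn_integral_bind[OF meas measurable_prob_algebraD[OF kernel(2)]])
        (simp add: nn_integral_distr[OF kernel(1)] meas)
    \<comment> \<open>Decoding the coins: the outer integral now runs over the families of index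
      sets themselves.\<close>
    also have "\<dots> = (\<integral>\<^sup>+ J. \<integral>\<^sup>+ h. ennreal ((?\<theta> - (\<Sum>j<t. score n m i z (J j) (h j)) / real t)\<^sup>2)
          \<partial>Pi\<^sub>M {..<t} (\<lambda>j. A (nths S (J j))) \<partial>map_pmf ?dec (nat_coded_pmf ?Q))"
      unfolding nn_integral_map_pmf estimates_influence_estimator n
      by (simp add: influence_estimator_def Let_def)
    also have "\<dots> \<le> ennreal (measure_pmf.expectation (pmf_of_set (draws n m))
        (\<lambda>J. \<integral>h. (score n m i z J h)\<^sup>2 \<partial>A (nths S J)) / real t)"
      unfolding map_nat_coded_pmf draws_pmf_def
    proof (rule mean_square_error_le)
      show "finite (set_pmf (pmf_of_set (draws n m)))"
        using draws_finite_nonempty_card[OF m i] by simp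
      show "prob_space (A (nths S J))" for J
        using A by (simp add: learning_algorithm_def)
      show "score n m i z J \<in> borel_measurable (A (nths S J))" for J
        using A measurable_score measurable_cong_sets[of "A (nths S J)" model_space borel borel]
        by (auto simp: learning_algorithm_def)
      show "\<bar>score n m i z J h\<bar> \<le> 1 / weight n m" for J h
        using weight_pos[OF m i] by (auto simp: score_def abs_mult of_bool_def divide_right_mono)
    qed (use t expectation_score[OF m i A n[symmetric]] in auto)
    also have "\<dots> = ennreal (1 / (2 * weight n m) / real t)"
      unfolding expectation_score_square[OF m i A] ..
    \<comment> \<open>Whichever term attains the minimum, \<open>p\<close> and \<open>1 - p\<close>
      are \<open>m / n\<close> and \<open>1 - m / n\<close> in some order, and the bound is
      symmetric in them.\<close>
    also have "\<dots> \<le> ennreal ((1 / p + 1 / (1 - p)) / real t)"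
      using weight_bound[OF m i mn] p
      by (intro ennreal_leI divide_right_mono) (auto simp: min_def)
    also have "\<dots> = 1 / ennreal (p * real t) + 1 / ennreal ((1 - p) * real t)"
    proof -
      have "p > 0" "1 - p > 0" using p m mn by (auto simp: min_def field_simps)
      moreover have "1 / ennreal a = ennreal (1 / a)" if "a > 0" for a
        using that divide_ennreal[of 1 a] by simp
      ultimately show ?thesis
        using t by (simp add: ennreal_plus[symmetric] add_divide_distrib del: ennreal_plus)
    qed
    also have "\<dots> \<le> ?rhs" by simp
    finally show ?thesis .
  qed
qed

end
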